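(* Let $p\ge 2$ and $m\ge 0$ be integers and $x\in[-1,1)$. Then \begin{align*} &(-1)^{p-1}\sum_{n=1}^\infty \left\{\frac{\zeta_n(p+2m+1)}{n^p}+\frac{\zeta_n(p)}{n^{p+2m+1}}\right\}\left(\sum_{k=1}^n\frac{x^k}{k}\right)\\ &=\sum_{i=1}^{p+2m}(-1)^{i-1}\mathrm{Li}_{p+2m+2-i}(x)\sum_{n=1}^\infty\frac{\zeta_n(p)}{n^i}x^n-\sum_{i=1}^{p-1}(-1)^{i-1}\mathrm{Li}_{p+1-i}(x)\sum_{n=1}^\infty\frac{\zeta_n(p+2m+1)}{n^i}x^n\\ &\quad+(-1)^p\ln(1-x)\sum_{n=1}^\infty\left\{\frac{\zeta_n(p+2m+1)}{n^p}+\frac{\zeta_n(p)}{n^{p+2m+1}}\right\}(1-x^n). \end{align*}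
   Context: For positive integers $k,n$, $\zeta_n(k)=\sum_{j=1}^n j^{-k}$. The polylogarithm is $\mathrm{Li}_s(x)=\sum_{n\ge1}x^n/n^s$ for $|x|\le 1$, $s\ge 2$, and $\mathrm{Li}_1(x)=-\ln(1-x)$. *)

theory Defs
  imports "HOL-Analysis.Analysis"
begin

definition zeta_partial :: "nat \<Rightarrow> nat \<Rightarrow> real" where
  "zeta_partial n k = (\<Sum>j=1..n. 1 / real j ^ k)"

text \<open>
  Intended for \<open>s \<ge> 1\<close> and \<open>\<bar>x\<bar> \<le> 1\<close>, with \<open>x < 1\<close> if \<open>s = 1\<close>. As series over \<open>nat\<close> start
  at 0, the summation index is shifted by one.
\<close>

definition polylog :: "nat \<Rightarrow> real \<Rightarrow> real" where
  "polylog s x = (if s = 1 then - ln (1 - x) else (\<Sum>n. x ^ Suc n / real (Suc n) ^ s))"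

end

theory Submission
  imports Defs
begin

text \<open>
  Put \<open>q = p + 2m + 1\<close> and let \<open>S\<^sub>i\<close> be the series of \<open>\<zeta>\<^sub>n(p) x\<^sup>n / n\<^sup>i\<close>. Multiplying out the Cauchy
  products, the sum over \<open>i = 1, \<dots>, q\<close> of \<open>(-1)\<^bsup>i-1\<^esup> Li\<^bsub>q+1-i\<^esub>(x) S\<^sub>i\<close> is a geometric sum in \<open>i\<close>, and
  the pair \<open>(j, n)\<close> contributes
  \<open>x\<^bsup>j+n\<^esup> / (j + n) \<cdot> \<zeta>\<^sub>n(p) \<cdot> (j\<^bsup>-q\<^esup> - (-1)\<^sup>q n\<^bsup>-q\<^esup>)\<close>.
  The sum of \<open>\<zeta>\<^sub>n(p) j\<^bsup>-q\<^esup>\<close> over \<open>j + n = N\<close> is the sum of \<open>a\<^bsup>-p\<^esup> j\<^bsup>-q\<^esup>\<close> over \<open>a + j \<le> N\<close>, hence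
  symmetric in \<open>p\<close> and \<open>q\<close>, so it cancels against the same expression with \<open>p\<close> and \<open>q\<close> exchanged.
  As \<open>p\<close> and \<open>q\<close> have opposite parity, the remaining terms add up, and summation by parts turns
  them into the left-hand side. At \<open>x = -1\<close> one factor of each product still converges absolutely,
  so Mertens' theorem applies.
\<close>

section \<open>Cauchy products and summation by parts\<close>

text \<open>The partial sums of the Cauchy product are sums of \<open>a i * B (n - i)\<close> over
  \<open>i < n\<close>, with \<open>B\<close> the bounded partial sums of \<open>b\<close>.
  Tannery's theorem with majorant \<open>norm (a i) * C\<close> moves the limit inside.\<close>

lemma Mertens_product_sums:
  fixes a b :: "nat \<Rightarrow> real"
  assumes a: "summable (\<lambda>k. norm (a k))" and b: "summable b"
  shows "(\<lambda>k. \<Sum>i\<le>k. a i * b (k - i)) sums (suminf a * suminf b)"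
proof -
  define B where "B n = (\<Sum>j<n. b j)" for n
  have B: "B \<longlonglongrightarrow> suminf b"
    unfolding B_def using summable_LIMSEQ[OF b] .
  then have "Bseq B"
    by (intro convergent_imp_Bseq convergentI)
  then obtain C where C: "\<And>n. norm (B n) \<le> C"
    by (meson BseqE)
  \<comment> \<open>Truncation at \<open>i < n\<close> writes the partial sums as full series in
    \<open>i\<close>, the form Tannery's theorem takes.\<close>
  define f where "f i n = (if i < n then a i * B (n - i) else 0)" for i n
  have "(\<lambda>n. f i n) \<longlonglongrightarrow> a i * suminf b" for i
  proof (rule Lim_transform_eventually)
    have "(\<lambda>n. B (n - i)) \<longlonglongrightarrow> suminf b"
      by (rule filterlim_compose[OF B filterlim_minus_const_nat_at_top])
    then show "(\<lambda>n. a i * B (n - i)) \<longlonglongrightarrow> a i * suminf b"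
      by (intro tendsto_intros)
    show "\<forall>\<^sub>F n in sequentially. a i * B (n - i) = f i n"
      using eventually_gt_at_top[of i] by eventually_elim (simp add: f_def)
  qed
  moreover have "norm (f i n) \<le> norm (a i) * C" for i n
    using C[of "n - i"] order_trans[OF norm_ge_zero C[of 0]]
    by (auto simp: f_def abs_mult intro!: mult_left_mono)
  then have "eventually (\<lambda>(i, n). norm (f i n) \<le> norm (a i) * C) (at_top \<times>\<^sub>F sequentially)"
    by (intro always_eventually) auto
  moreover have "summable (\<lambda>i. norm (a i) * C)"
    using a by (rule summable_mult2)
  ultimately have "(\<lambda>n. \<Sum>i. f i n) \<longlonglongrightarrow> (\<Sum>i. a i * suminf b)"
    using tannerys_theorem[of f "\<lambda>i. a i * suminf b" sequentially "\<lambda>i. norm (a i) * C"] by auto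
  also have "(\<Sum>i. a i * suminf b) = suminf a * suminf b"
    using summable_norm_cancel[OF a] by (rule suminf_mult2[symmetric])
  also have "(\<lambda>n. \<Sum>i. f i n) = (\<lambda>n. \<Sum>k<n. \<Sum>i\<le>k. a i * b (k - i))"
  proof
    fix n
    have "(\<Sum>i. f i n) = (\<Sum>i<n. f i n)"
      by (rule suminf_finite) (auto simp: f_def)
    also have "\<dots> = (\<Sum>i<n. \<Sum>j<n - i. a i * b j)"
      by (simp add: f_def B_def sum_distrib_left)
    also have "\<dots> = (\<Sum>(i, j)\<in>{(i, j). i + j < n}. a i * b j)"
      by (subst sum.Sigma) (auto intro!: sum.cong)
    also have "\<dots> = (\<Sum>k<n. \<Sum>i\<le>k. a i * b (k - i))"
      by (rule sum.triangle_reindex)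
    finally show "(\<Sum>i. f i n) = (\<Sum>k<n. \<Sum>i\<le>k. a i * b (k - i))" .
  qed
  finally show ?thesis
    by (simp add: sums_def)
qed

text \<open>Abel summation. The partial sums \<open>H\<close> of \<open>h\<close> are only bounded,
  but \<open>a\<close> is absolutely summable, so the series of \<open>a n * H n\<close>
  converges.\<close>

lemma summation_by_parts_sums:
  fixes a h :: "nat \<Rightarrow> real"
  assumes a: "summable (\<lambda>n. norm (a n))" and h: "h sums L"
  shows "(\<lambda>k. h (Suc k) * (\<Sum>n\<le>k. a n)) sums (L * suminf a - (\<Sum>n. a n * (\<Sum>k\<le>n. h k)))"
proof -
  define H where "H n = (\<Sum>k\<le>n. h k)" for n
  have H: "H \<longlonglongrightarrow> L"
    unfolding H_def using h by (simp add: sums_def_le)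
  then have "Bseq H"
    by (intro convergent_imp_Bseq convergentI)
  then obtain C where C: "\<And>n. norm (H n) \<le> C"
    by (meson BseqE)
  have aH: "summable (\<lambda>n. a n * H n)"
  proof (rule summable_comparison_test')
    show "summable (\<lambda>n. norm (a n) * C)"
      using a by (rule summable_mult2)
    show "norm (a n * H n) \<le> norm (a n) * C" for n
      using C[of n] by (auto simp: abs_mult intro!: mult_left_mono)
  qed
  have "(\<Sum>k<n. h (Suc k) * (\<Sum>i\<le>k. a i)) = H n * (\<Sum>i<n. a i) - (\<Sum>i<n. a i * H i)" for n
    by (induction n) (simp_all add: H_def lessThan_Suc_atMost[symmetric] algebra_simps)
  moreover have "(\<lambda>n. H n * (\<Sum>i<n. a i) - (\<Sum>i<n. a i * H i)) \<longlonglongrightarrow> L * suminf a - (\<Sum>n. a n * H n)"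
    by (intro tendsto_intros H summable_LIMSEQ aH summable_norm_cancel[OF a])
  ultimately show ?thesis
    by (simp add: sums_def H_def)
qed

section \<open>Convergence of the zeta and polylogarithm series\<close>

lemma summable_inverse_power_Suc:
  assumes "s \<ge> 2"
  shows "summable (\<lambda>n. 1 / real (Suc n) ^ s)"
  using inverse_power_summable[OF assms, where 'a = real]
  by (subst summable_Suc_iff[of "\<lambda>n. 1 / real n ^ s"]) (simp add: inverse_eq_divide)

lemma summable_bounded_coeff_powser:
  fixes c :: "nat \<Rightarrow> real"
  assumes c: "\<And>n. norm (c n) \<le> C" and x: "\<bar>x\<bar> \<le> 1" and s: "s \<ge> 2 \<or> \<bar>x\<bar> < 1"
  shows "summable (\<lambda>n. norm (c n / real (Suc n) ^ s * x ^ Suc n))"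
proof -
  have le: "norm (c n / real (Suc n) ^ s * x ^ Suc n) \<le> C * (1 / real (Suc n) ^ s * \<bar>x\<bar> ^ Suc n)" for n
    using mult_right_mono[OF c[of n], of "1 / real (Suc n) ^ s * \<bar>x\<bar> ^ Suc n"]
    by (simp add: abs_mult power_abs)
  have "summable (\<lambda>n. 1 / real (Suc n) ^ s * \<bar>x\<bar> ^ Suc n)"
  proof (cases "s \<ge> 2")
    case True
    show ?thesis
    proof (rule summable_comparison_test'[OF summable_inverse_power_Suc[OF True]])
      show "norm (1 / real (Suc n) ^ s * \<bar>x\<bar> ^ Suc n) \<le> 1 / real (Suc n) ^ s" for n
        using mult_left_mono[OF power_le_one[OF abs_ge_zero x, of "Suc n"], of "1 / real (Suc n) ^ s"]
        by (simp add: abs_mult power_abs)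
    qed
  next
    case False
    then have "summable (\<lambda>n. \<bar>x\<bar> ^ Suc n)"
      using s by (subst summable_Suc_iff) auto
    then show ?thesis
    proof (rule summable_comparison_test')
      have "1 \<le> real (Suc n) ^ s" for n
        by (rule one_le_power) simp
      then show "norm (1 / real (Suc n) ^ s * \<bar>x\<bar> ^ Suc n) \<le> \<bar>x\<bar> ^ Suc n" for n
        using mult_right_mono[of "1 / real (Suc n) ^ s" 1 "\<bar>x\<bar> ^ Suc n"]
        by (simp add: abs_mult power_abs)
    qed
  qed
  then have "summable (\<lambda>n. C * (1 / real (Suc n) ^ s * \<bar>x\<bar> ^ Suc n))"
    by (rule summable_mult)
  then show ?thesis
    by (rule summable_comparison_test') (use le in simp)
qed

lemma zeta_partial_Suc: "zeta_partial (Suc n) k = zeta_partial n k + 1 / real (Suc n) ^ k"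
  by (simp add: zeta_partial_def)

lemma zeta_partial_nonneg: "zeta_partial n k \<ge> 0"
  unfolding zeta_partial_def by (intro sum_nonneg) auto

text \<open>Due to the term \<open>j = 1\<close>; gives the monotonicity in the Leibniz test
  below.\<close>

lemma zeta_partial_Suc_ge_1: "zeta_partial (Suc n) k \<ge> 1"
proof (induction n)
  case (Suc n)
  then show ?case
    by (subst zeta_partial_Suc) (simp add: add_increasing2)
qed (simp add: zeta_partial_def)

lemma zeta_partial_bounded:
  assumes "k \<ge> 2"
  obtains C where "\<And>n. norm (zeta_partial n k) \<le> C"
proof
  fix n
  have "zeta_partial n k = (\<Sum>j<n. 1 / real (Suc j) ^ k)"
    by (simp add: zeta_partial_def sum.atLeast1_atMost_eq)
  also have "\<dots> \<le> (\<Sum>j. 1 / real (Suc j) ^ k)"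
    by (intro sum_le_suminf summable_inverse_power_Suc assms) auto
  finally show "norm (zeta_partial n k) \<le> (\<Sum>j. 1 / real (Suc j) ^ k)"
    using zeta_partial_nonneg[of n k] by simp
qed

lemma summable_norm_zeta_powser:
  assumes "p \<ge> 2" "s \<ge> 2" "\<bar>x\<bar> \<le> 1"
  shows "summable (\<lambda>n. norm (zeta_partial (Suc n) p / real (Suc n) ^ s * x ^ Suc n))"
proof -
  obtain C where "\<And>n. norm (zeta_partial n p) \<le> C"
    using zeta_partial_bounded[OF assms(1)] by blast
  then show ?thesis
    using assms by (intro summable_bounded_coeff_powser[where C = C]) auto
qed

text \<open>Convergence is absolute except at \<open>s = 1\<close>, \<open>x = -1\<close>, where the
  Leibniz test applies.\<close>

lemma summable_zeta_powser:
  assumes p: "p \<ge> 2" and s: "s \<ge> 1" and x: "x \<in> {-1..<1}"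
  shows "summable (\<lambda>n. zeta_partial (Suc n) p / real (Suc n) ^ s * x ^ Suc n)"
proof -
  obtain C where C: "\<And>n. norm (zeta_partial n p) \<le> C"
    using zeta_partial_bounded[OF p] by blast
  show ?thesis
  proof (cases "s \<ge> 2 \<or> \<bar>x\<bar> < 1")
    case True
    then show ?thesis
      using C x by (intro summable_norm_cancel[OF summable_bounded_coeff_powser[where C = C]]) auto
  next
    case False
    then have [simp]: "s = 1" "x = -1"
      using s x by auto
    have "(\<lambda>n. zeta_partial (Suc n) p / real (Suc n)) \<longlonglongrightarrow> 0"
    proof (rule Lim_null_comparison)
      show "\<forall>\<^sub>F n in sequentially. norm (zeta_partial (Suc n) p / real (Suc n)) \<le> C / real (Suc n)"
        using C by (intro always_eventually allI) (simp add: divide_right_mono)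
      show "(\<lambda>n. C / real (Suc n)) \<longlonglongrightarrow> 0"
        by (rule LIMSEQ_Suc[OF lim_const_over_n])
    qed
    moreover have "zeta_partial (Suc (Suc n)) p / real (Suc (Suc n)) \<le> zeta_partial (Suc n) p / real (Suc n)" for n
    proof -
      \<comment> \<open>With \<open>N = Suc n\<close>, clearing denominators reduces the claim to
        \<open>N / (N + 1) ^ p \<le> zeta_partial N p\<close>; the number 1 separates the two
        sides.\<close>
      have "real (Suc n) * (1 / real (Suc (Suc n)) ^ p) \<le> 1"
      proof -
        have "real (Suc (Suc n)) ^ 1 \<le> real (Suc (Suc n)) ^ p"
          using p by (intro power_increasing) auto
        then show ?thesis
          by (simp add: divide_simps)
      qed
      also note zeta_partial_Suc_ge_1[of n p]
      finally have "real (Suc n) * zeta_partial (Suc (Suc n)) p \<le> real (Suc (Suc n)) * zeta_partial (Suc n) p"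
        unfolding zeta_partial_Suc[of "Suc n"] by (simp add: algebra_simps)
      then show ?thesis
        by (simp add: field_simps)
    qed
    ultimately have "summable (\<lambda>n. (-1) ^ n * (zeta_partial (Suc n) p / real (Suc n)))"
      by (intro summable_Leibniz') (auto intro: divide_nonneg_pos zeta_partial_nonneg)
    then have "summable (\<lambda>n. - ((-1) ^ n * (zeta_partial (Suc n) p / real (Suc n))))"
      by (rule summable_minus)
    then show ?thesis
      by (simp add: mult.commute)
  qed
qed

lemma summable_norm_polylog:
  assumes "s \<ge> 2" "\<bar>x\<bar> \<le> 1"
  shows "summable (\<lambda>n. norm (x ^ Suc n / real (Suc n) ^ s))"
  using summable_bounded_coeff_powser[of "\<lambda>_. 1" 1 x s] assms by simp

text \<open>Reconciles the closed form chosen for \<open>s = 1\<close> with the series, also at the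
  endpoint \<open>x = -1\<close>.\<close>

lemma polylog_sums:
  assumes s: "s \<ge> 1" and x: "x \<in> {-1..<1}"
  shows "(\<lambda>n. x ^ Suc n / real (Suc n) ^ s) sums polylog s x"
proof (cases "s \<ge> 2")
  case True
  then show ?thesis
    using summable_norm_cancel[OF summable_norm_polylog[of s x]] x
    by (auto simp: polylog_def intro: summable_sums)
next
  case False
  then have [simp]: "s = 1"
    using s by simp
  show ?thesis
  proof (cases "x = -1")
    case True
    then show ?thesis
      using sums_minus[OF alternating_harmonic_series_sums] by (simp add: polylog_def)
  next
    case False
    then have "(\<lambda>n. - (x ^ n / real n)) sums ln (1 - x)"
      using ln_series'[of "-x"] x by (simp add: abs_less_iff)
    then have "(\<lambda>n. x ^ n / real n) sums (- ln (1 - x))"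
      using sums_minus by fastforce
    \<comment> \<open>The shift changes nothing: the term at \<open>n = 0\<close> is a division by
      zero, hence 0.\<close>
    then show ?thesis
      by (subst sums_Suc_iff) (simp add: polylog_def)
  qed
qed

section \<open>Two finite identities\<close>

text \<open>Passing from \<open>k\<close> to \<open>Suc k\<close> adds the pairs of positive
  integers with sum \<open>k + 3\<close>, and reflecting this diagonal exchanges \<open>p\<close>
  and \<open>q\<close>.\<close>

lemma zeta_convolution_symmetric:
  "(\<Sum>j\<le>k. zeta_partial (Suc (k - j)) p / real (Suc j) ^ q) =
   (\<Sum>j\<le>k. zeta_partial (Suc (k - j)) q / real (Suc j) ^ p)"
proof (induction k)
  case (Suc k)
  have step: "(\<Sum>j\<le>Suc k. zeta_partial (Suc (Suc k - j)) p / real (Suc j) ^ q) =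
      (\<Sum>j\<le>k. zeta_partial (Suc (k - j)) p / real (Suc j) ^ q) +
      (\<Sum>j\<le>Suc k. 1 / (real (Suc (Suc k - j)) ^ p * real (Suc j) ^ q))" for p q
  proof -
    have "(\<Sum>j\<le>k. zeta_partial (Suc (Suc k - j)) p / real (Suc j) ^ q) =
      (\<Sum>j\<le>k. zeta_partial (Suc (k - j)) p / real (Suc j) ^ q +
              1 / (real (Suc (Suc k - j)) ^ p * real (Suc j) ^ q))"
    proof (rule sum.cong)
      fix j assume "j \<in> {..k}"
      then have "zeta_partial (Suc (Suc k - j)) p =
          zeta_partial (Suc (k - j)) p + 1 / real (Suc (Suc k - j)) ^ p"
        by (simp add: Suc_diff_le zeta_partial_Suc)
      then show "zeta_partial (Suc (Suc k - j)) p / real (Suc j) ^ q =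
          zeta_partial (Suc (k - j)) p / real (Suc j) ^ q +
          1 / (real (Suc (Suc k - j)) ^ p * real (Suc j) ^ q)"
        by (simp add: add_divide_distrib)
    qed simp
    \<comment> \<open>The remaining summand \<open>j = Suc k\<close> has the zeta factor
      \<open>zeta_partial 1 p = 1\<close>.\<close>
    then show ?thesis
      by (simp add: sum.distrib zeta_partial_def)
  qed
  have "(\<Sum>j\<le>Suc k. 1 / (real (Suc (Suc k - j)) ^ p * real (Suc j) ^ q)) =
        (\<Sum>j\<le>Suc k. 1 / (real (Suc (Suc k - j)) ^ q * real (Suc j) ^ p))"
    by (rule sum.reindex_bij_witness[where i = "\<lambda>j. Suc k - j" and j = "\<lambda>j. Suc k - j"])
       (auto simp: mult.commute)
  then show ?case
    unfolding step[of p q] step[of q p] Suc.IH by simp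
qed (simp add: zeta_partial_def)

text \<open>A geometric sum of ratio \<open>- u / v\<close>. Raising \<open>q\<close> divides the
  old terms by \<open>u\<close> and appends one.\<close>

lemma alternating_reciprocal_sum:
  fixes u v :: real
  assumes "u > 0" "v > 0"
  shows "(\<Sum>i=1..q. (-1) ^ (i - 1) / (u ^ (q + 1 - i) * v ^ i)) =
         (1 / u ^ q - (-1) ^ q / v ^ q) / (u + v)"
proof (induction q)
  case (Suc q)
  have "(\<Sum>i=1..Suc q. (-1) ^ (i - 1) / (u ^ (Suc q + 1 - i) * v ^ i)) =
        (\<Sum>i=1..q. (-1) ^ (i - 1) / (u ^ (q + 1 - i) * v ^ i)) / u + (-1) ^ q / (u * v ^ Suc q)"
    by (simp add: sum_divide_distrib Suc_diff_le mult_ac)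
  also have "\<dots> = (1 / u ^ q - (-1) ^ q / v ^ q) / (u + v) / u + (-1) ^ q / (u * v ^ Suc q)"
    by (simp only: Suc.IH)
  also have "\<dots> = (1 / u ^ Suc q - (-1) ^ Suc q / v ^ Suc q) / (u + v)"
  proof -
    have "u + v \<noteq> 0" "u \<noteq> 0" "v \<noteq> 0"
      using assms by auto
    then show ?thesis
      by (simp add: divide_simps) (simp add: algebra_simps)
  qed
  finally show ?case .
qed simp

section \<open>Products of polylogarithms with zeta series\<close>

text \<open>Assumption \<open>si\<close> makes at least one factor absolutely convergent, even at
  \<open>x = -1\<close>.\<close>

lemma polylog_times_zeta_powser_sums:
  assumes p: "p \<ge> 2" and x: "x \<in> {-1..<1}" and i: "i \<ge> 1" and s: "s \<ge> 1" and si: "s \<ge> 2 \<or> i \<ge> 2"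
  shows "(\<lambda>k. \<Sum>j\<le>k. x ^ Suc j / real (Suc j) ^ s *
                (zeta_partial (Suc (k - j)) p / real (Suc (k - j)) ^ i * x ^ Suc (k - j)))
         sums (polylog s x * (\<Sum>n. zeta_partial (Suc n) p / real (Suc n) ^ i * x ^ Suc n))"
proof (cases "s \<ge> 2")
  case True
  have "summable (\<lambda>n. norm (x ^ Suc n / real (Suc n) ^ s))"
    using True x by (intro summable_norm_polylog) auto
  from Mertens_product_sums[OF this summable_zeta_powser[OF p i x]] show ?thesis
    unfolding sums_unique[OF polylog_sums[OF s x], symmetric] .
next
  case False
  define l where "l = (\<lambda>n. x ^ Suc n / real (Suc n) ^ s)"
  define z where "z = (\<lambda>n. zeta_partial (Suc n) p / real (Suc n) ^ i * x ^ Suc n)"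
  have l: "l sums polylog s x"
    unfolding l_def using polylog_sums[OF s x] .
  have "summable (\<lambda>n. norm (z n))"
    unfolding z_def using False si x by (intro summable_norm_zeta_powser p) auto
  \<comment> \<open>Now the zeta series is the absolutely convergent factor, so it comes first;
    reflecting \<open>j\<close> restores the order.\<close>
  then have "(\<lambda>k. \<Sum>j\<le>k. z j * l (k - j)) sums (suminf z * suminf l)"
    using l by (intro Mertens_product_sums) (auto simp: sums_iff)
  moreover have "(\<Sum>j\<le>k. z j * l (k - j)) = (\<Sum>j\<le>k. l j * z (k - j))" for k
    by (rule sum.reindex_bij_witness[where i = "\<lambda>j. k - j" and j = "\<lambda>j. k - j"])
       (auto simp: mult.commute)
  ultimately have "(\<lambda>k. \<Sum>j\<le>k. l j * z (k - j)) sums (polylog s x * suminf z)"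
    using sums_unique[OF l] by (simp add: mult.commute)
  then show ?thesis
    by (simp only: l_def z_def)
qed

text \<open>No parity relation is imposed, so the lemma serves twice, with \<open>p\<close> and
  \<open>q\<close> exchanged. Both factors start at exponent 1, so index \<open>k\<close> belongs to
  the power \<open>k + 2\<close> of \<open>x\<close>.\<close>

lemma alternating_polylog_zeta_sums:
  assumes p: "p \<ge> 2" and q: "q \<ge> 2" and x: "x \<in> {-1..<1}"
  shows "(\<lambda>k. x ^ Suc (Suc k) / real (Suc (Suc k)) *
            ((\<Sum>j\<le>k. zeta_partial (Suc (k - j)) p / real (Suc j) ^ q)
             - (-1) ^ q * (\<Sum>n\<le>k. zeta_partial (Suc n) p / real (Suc n) ^ q)))
         sums (\<Sum>i=1..q. (-1) ^ (i - 1) * polylog (q + 1 - i) x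
                 * (\<Sum>n. zeta_partial (Suc n) p / real (Suc n) ^ i * x ^ Suc n))"
proof -
  define c where "c i k = (\<Sum>j\<le>k. x ^ Suc j / real (Suc j) ^ (q + 1 - i) *
      (zeta_partial (Suc (k - j)) p / real (Suc (k - j)) ^ i * x ^ Suc (k - j)))" for i k
  \<comment> \<open>As \<open>q \<ge> 2\<close>, the exponents \<open>i\<close> and
    \<open>q + 1 - i\<close> are never both 1.\<close>
  have "(\<lambda>k. \<Sum>i=1..q. (-1) ^ (i - 1) * c i k) sums
      (\<Sum>i=1..q. (-1) ^ (i - 1) * (polylog (q + 1 - i) x
         * (\<Sum>n. zeta_partial (Suc n) p / real (Suc n) ^ i * x ^ Suc n)))"
    unfolding c_def
    by (intro sums_sum sums_mult polylog_times_zeta_powser_sums p x) (use q in auto)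
  moreover have "(\<Sum>i=1..q. (-1) ^ (i - 1) * c i k) = x ^ Suc (Suc k) / real (Suc (Suc k)) *
      ((\<Sum>j\<le>k. zeta_partial (Suc (k - j)) p / real (Suc j) ^ q)
       - (-1) ^ q * (\<Sum>n\<le>k. zeta_partial (Suc n) p / real (Suc n) ^ q))" for k
  proof -
    have "(\<Sum>i=1..q. (-1) ^ (i - 1) * c i k) =
        (\<Sum>j\<le>k. \<Sum>i=1..q. (-1) ^ (i - 1) * (x ^ Suc j / real (Suc j) ^ (q + 1 - i) *
          (zeta_partial (Suc (k - j)) p / real (Suc (k - j)) ^ i * x ^ Suc (k - j))))"
      unfolding c_def sum_distrib_left by (rule sum.swap)
    also have "\<dots> = (\<Sum>j\<le>k. x ^ Suc (Suc k) / real (Suc (Suc k)) *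
        (zeta_partial (Suc (k - j)) p / real (Suc j) ^ q
          - (-1) ^ q * (zeta_partial (Suc (k - j)) p / real (Suc (k - j)) ^ q)))"
    proof (rule sum.cong)
      fix j assume j: "j \<in> {..k}"
      then have pow: "x ^ Suc j * x ^ Suc (k - j) = x ^ Suc (Suc k)"
        by (simp flip: power_add)
      have add: "real (Suc j) + real (Suc (k - j)) = real (Suc (Suc k))"
        using j by simp
      \<comment> \<open>For a fixed pair of indices only the reciprocal powers depend on
        \<open>i\<close>.\<close>
      have "(\<Sum>i=1..q. (-1) ^ (i - 1) * (x ^ Suc j / real (Suc j) ^ (q + 1 - i) *
          (zeta_partial (Suc (k - j)) p / real (Suc (k - j)) ^ i * x ^ Suc (k - j)))) =
        x ^ Suc j * x ^ Suc (k - j) * zeta_partial (Suc (k - j)) p *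
          (\<Sum>i=1..q. (-1) ^ (i - 1) / (real (Suc j) ^ (q + 1 - i) * real (Suc (k - j)) ^ i))"
        unfolding sum_distrib_left
        by (intro sum.cong refl)
           (simp only: times_divide_eq_left times_divide_eq_right divide_divide_eq_left mult_ac)
      also have "\<dots> = x ^ Suc (Suc k) * zeta_partial (Suc (k - j)) p *
          ((1 / real (Suc j) ^ q - (-1) ^ q / real (Suc (k - j)) ^ q) / real (Suc (Suc k)))"
        by (subst alternating_reciprocal_sum) (simp_all only: pow add of_nat_0_less_iff zero_less_Suc)
      also have "\<dots> = x ^ Suc (Suc k) / real (Suc (Suc k)) *
          (zeta_partial (Suc (k - j)) p / real (Suc j) ^ q
            - (-1) ^ q * (zeta_partial (Suc (k - j)) p / real (Suc (k - j)) ^ q))"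
        by (simp add: algebra_simps diff_divide_distrib del: of_nat_Suc power_Suc)
      finally show "(\<Sum>i=1..q. (-1) ^ (i - 1) * (x ^ Suc j / real (Suc j) ^ (q + 1 - i) *
          (zeta_partial (Suc (k - j)) p / real (Suc (k - j)) ^ i * x ^ Suc (k - j)))) =
        x ^ Suc (Suc k) / real (Suc (Suc k)) *
          (zeta_partial (Suc (k - j)) p / real (Suc j) ^ q
            - (-1) ^ q * (zeta_partial (Suc (k - j)) p / real (Suc (k - j)) ^ q))" .
    qed simp
    also have "\<dots> = x ^ Suc (Suc k) / real (Suc (Suc k)) *
        ((\<Sum>j\<le>k. zeta_partial (Suc (k - j)) p / real (Suc j) ^ q)
         - (-1) ^ q * (\<Sum>j\<le>k. zeta_partial (Suc (k - j)) p / real (Suc (k - j)) ^ q))"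
      unfolding sum_distrib_left[symmetric] sum_subtractf ..
    also have "(\<Sum>j\<le>k. zeta_partial (Suc (k - j)) p / real (Suc (k - j)) ^ q) =
        (\<Sum>n\<le>k. zeta_partial (Suc n) p / real (Suc n) ^ q)"
      by (rule sum.reindex_bij_witness[where i = "\<lambda>j. k - j" and j = "\<lambda>j. k - j"]) auto
    finally show ?thesis .
  qed
  ultimately show ?thesis
    by (simp only: mult.assoc)
qed

section \<open>Exchanging \<open>p\<close> and \<open>q\<close> and collecting the
  logarithms\<close>

theorem theorem2p2:
  fixes p m :: nat and x :: real
  assumes "p \<ge> 2" and "x \<in> {-1..<1}"
  shows "(-1) ^ (p - 1) *
      (\<Sum>n. (zeta_partial (Suc n) (p + 2*m + 1) / real (Suc n) ^ p
             + zeta_partial (Suc n) p / real (Suc n) ^ (p + 2*m + 1))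
            * (\<Sum>k=1..Suc n. x ^ k / real k))
    = (\<Sum>i=1..p + 2*m. (-1) ^ (i - 1) * polylog (p + 2*m + 2 - i) x
         * (\<Sum>n. zeta_partial (Suc n) p / real (Suc n) ^ i * x ^ Suc n))
      - (\<Sum>i=1..p - 1. (-1) ^ (i - 1) * polylog (p + 1 - i) x
         * (\<Sum>n. zeta_partial (Suc n) (p + 2*m + 1) / real (Suc n) ^ i * x ^ Suc n))
      + (-1) ^ p * ln (1 - x)
         * (\<Sum>n. (zeta_partial (Suc n) (p + 2*m + 1) / real (Suc n) ^ p
                  + zeta_partial (Suc n) p / real (Suc n) ^ (p + 2*m + 1))
                 * (1 - x ^ Suc n))"
proof -
  define q where "q = p + 2*m + 1"
  note p = assms(1) and x = assms(2)
  have q: "q \<ge> 2"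
    using p by (simp add: q_def)
  define a where "a n = zeta_partial (Suc n) q / real (Suc n) ^ p
      + zeta_partial (Suc n) p / real (Suc n) ^ q" for n
  define S where "S r i = (\<Sum>n. zeta_partial (Suc n) r / real (Suc n) ^ i * x ^ Suc n)" for r i
  define e where "e = (-1 :: real) ^ p"
  have eq: "(-1) ^ q = - e"
    by (simp add: e_def q_def power_add power_mult)
  have ep: "(-1) ^ (p - 1) = - e"
    using p by (cases p) (simp_all add: e_def)

  \<comment> \<open>The zeta series at the point 1, where exponents at least 2 still give
    convergence.\<close>
  have a_norm: "summable (\<lambda>n. norm (a n))"
    using summable_add[OF summable_norm_zeta_powser[OF q p, of 1] summable_norm_zeta_powser[OF p q, of 1]]
    by (simp add: a_def zeta_partial_nonneg add_nonneg_nonneg)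
  then have a: "summable a"
    by (rule summable_norm_cancel)
  have ax: "(\<lambda>n. a n * x ^ Suc n) sums (S q p + S p q)"
    using sums_add[OF summable_sums[OF summable_zeta_powser[OF q _ x, of p]]
        summable_sums[OF summable_zeta_powser[OF p _ x, of q]]] p q
    by (simp add: a_def S_def distrib_right)

  \<comment> \<open>Here \<open>h k = x ^ Suc k / real (Suc k)\<close>, with sum
    \<open>- ln (1 - x)\<close>.\<close>
  have parts: "(\<lambda>k. x ^ Suc (Suc k) / real (Suc (Suc k)) * (\<Sum>n\<le>k. a n)) sums
      (- ln (1 - x) * suminf a - (\<Sum>n. a n * (\<Sum>k=1..Suc n. x ^ k / real k)))"
    using summation_by_parts_sums[OF a_norm polylog_sums[OF order_refl x]]
    by (simp add: polylog_def sum.atLeast1_atMost_eq lessThan_Suc_atMost del: sum.lessThan_Suc sum.cl_ivl_Suc)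
  have "(\<lambda>k. x ^ Suc (Suc k) / real (Suc (Suc k)) *
            ((\<Sum>j\<le>k. zeta_partial (Suc (k - j)) p / real (Suc j) ^ q)
             - (-1) ^ q * (\<Sum>n\<le>k. zeta_partial (Suc n) p / real (Suc n) ^ q)) -
          x ^ Suc (Suc k) / real (Suc (Suc k)) *
            ((\<Sum>j\<le>k. zeta_partial (Suc (k - j)) q / real (Suc j) ^ p)
             - (-1) ^ p * (\<Sum>n\<le>k. zeta_partial (Suc n) q / real (Suc n) ^ p)))
      sums ((\<Sum>i=1..q. (-1) ^ (i - 1) * polylog (q + 1 - i) x * S p i)
            - (\<Sum>i=1..p. (-1) ^ (i - 1) * polylog (p + 1 - i) x * S q i))"
    unfolding S_def
    by (rule sums_diff[OF alternating_polylog_zeta_sums[OF p q x] alternating_polylog_zeta_sums[OF q p x]])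
  \<comment> \<open>The convolutions cancel; since \<open>(-1) ^ q = - e\<close>, the other two sums
    both get the sign \<open>e\<close> and combine to that of \<open>a\<close>.\<close>
  moreover have "x ^ Suc (Suc k) / real (Suc (Suc k)) *
            ((\<Sum>j\<le>k. zeta_partial (Suc (k - j)) p / real (Suc j) ^ q)
             - (-1) ^ q * (\<Sum>n\<le>k. zeta_partial (Suc n) p / real (Suc n) ^ q)) -
          x ^ Suc (Suc k) / real (Suc (Suc k)) *
            ((\<Sum>j\<le>k. zeta_partial (Suc (k - j)) q / real (Suc j) ^ p)
             - (-1) ^ p * (\<Sum>n\<le>k. zeta_partial (Suc n) q / real (Suc n) ^ p)) =
        e * (x ^ Suc (Suc k) / real (Suc (Suc k)) * (\<Sum>n\<le>k. a n))" for k
    unfolding zeta_convolution_symmetric[of k p q] eq a_def sum.distrib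
    unfolding e_def by (simp only: algebra_simps)
  ultimately have total: "(\<Sum>i=1..q. (-1) ^ (i - 1) * polylog (q + 1 - i) x * S p i)
            - (\<Sum>i=1..p. (-1) ^ (i - 1) * polylog (p + 1 - i) x * S q i) =
      e * (- ln (1 - x) * suminf a - (\<Sum>n. a n * (\<Sum>k=1..Suc n. x ^ k / real k)))"
    using sums_unique2 sums_mult[OF parts, of e] by simp
  \<comment> \<open>The last terms, \<open>i = q\<close> here and \<open>i = p\<close> below,
    contain \<open>polylog 1 x = - ln (1 - x)\<close>, with signs \<open>e\<close> and
    \<open>- e\<close>.\<close>
  have split_p: "(\<Sum>i=1..q. (-1) ^ (i - 1) * polylog (q + 1 - i) x * S p i) =
      (\<Sum>i=1..p + 2*m. (-1) ^ (i - 1) * polylog (p + 2*m + 2 - i) x * S p i) - e * ln (1 - x) * S p q"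
    by (simp add: q_def polylog_def e_def power_add power_mult)
  have split_q: "(\<Sum>i=1..p. (-1) ^ (i - 1) * polylog (p + 1 - i) x * S q i) =
      (\<Sum>i=1..p - 1. (-1) ^ (i - 1) * polylog (p + 1 - i) x * S q i) + e * ln (1 - x) * S q p"
    using p ep by (cases p) (simp_all add: polylog_def)
  \<comment> \<open>The factor \<open>1 - x ^ Suc n\<close> merges the logarithmic term from
    summation by parts with the two split off above.\<close>
  have split_a: "(\<Sum>n. a n * (1 - x ^ Suc n)) = suminf a - (S q p + S p q)"
    using sums_unique[OF sums_diff[OF summable_sums[OF a] ax]] by (simp add: right_diff_distrib)
  have "- e * T = P' - Q' + e * l * U"
    if "P - Q = e * (- l * A - T)" "P = P' - e * l * V" "Q = Q' + e * l * W" "U = A - (W + V)"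
    for P Q P' Q' T U V W A l :: real
    using that by algebra
  from this[OF total split_p split_q split_a]
  have "- e * (\<Sum>n. a n * (\<Sum>k=1..Suc n. x ^ k / real k)) =
      (\<Sum>i=1..p + 2*m. (-1) ^ (i - 1) * polylog (p + 2*m + 2 - i) x * S p i)
      - (\<Sum>i=1..p - 1. (-1) ^ (i - 1) * polylog (p + 1 - i) x * S q i)
      + e * ln (1 - x) * (\<Sum>n. a n * (1 - x ^ Suc n))"
    .
  then show ?thesis
    unfolding a_def S_def ep[symmetric] unfolding e_def q_def .
qed

end
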